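(* Let $H$ be a finite bipartite graph and let $\tilde{H}$ be its extended line graph. Then for every integer $d\geq 1$ and every $d$-regular simple graph $G$ on $n$ vertices, $$\hom(G,\tilde{H})\leq \hom(K_{d+1},\tilde{H})^{n/(d+1)},$$ equivalently $p_{\tilde{H}}(G)\leq p_{\tilde{H}}(K_{d+1})$.
   Context: For graphs $G$ and $H$ (where $H$ may have loops), a homomorphism is a map $\varphi:V(G)\to V(H)$ such that $(\varphi(u),\varphi(v))\in E(H)$ whenever $(u,v)\in E(G)$; $\hom(G,H)$ denotes the number of homomorphisms from $G$ to $H$, and $p_H(G)=\hom(G,H)^{1/|V(G)|}$. $K_{d+1}$ is the complete graph on $d+1$ vertices. The extended line graph $\tilde{H}$ of a bipartite graph $H$ has vertex set $E(H)$, and two edges $e,f$ of $H$ are adjacent in $\tilde{H}$ if (a) $e=f$ (so every vertex of $\tilde{H}$ has a loop), or (b) $e$ and $f$ share a common vertex, or (c) $e$ and $f$ are opposite edges of a $4$-cycle in $H$. *)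

theory Defs
  imports Complex_Main "HOL-Library.FuncSet" "Graph_Theory.Graph_Theory"
begin

text \<open>
  Graphs are symmetric digraphs without parallel arcs: an undirected edge between \<open>u\<close> and \<open>v\<close> is
  represented by the two arcs \<open>(u, v)\<close> and \<open>(v, u)\<close>, a loop at \<open>v\<close> by the arc \<open>(v, v)\<close>. The locale
  \<^locale>\<open>pair_graph\<close> describes the finite simple graphs, \<^locale>\<open>pair_pseudo_graph\<close> the finite graphs
  that may have loops.
\<close>

text \<open>Maps are extensional, so that each map on the vertex set is counted exactly once.\<close>

definition graph_homs :: "'a pair_pre_digraph \<Rightarrow> 'b pair_pre_digraph \<Rightarrow> ('a \<Rightarrow> 'b) set" where
  "graph_homs G H =
    {\<phi> \<in> pverts G \<rightarrow>\<^sub>E pverts H. \<forall>(u, v) \<in> parcs G. (\<phi> u, \<phi> v) \<in> parcs H}"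

definition hom_count :: "'a pair_pre_digraph \<Rightarrow> 'b pair_pre_digraph \<Rightarrow> nat" where
  "hom_count G H = card (graph_homs G H)"

definition normalized_hom_count :: "'b pair_pre_digraph \<Rightarrow> 'a pair_pre_digraph \<Rightarrow> real" where
  "normalized_hom_count H G = real (hom_count G H) powr (1 / real (card (pverts G)))"

definition regular_graph :: "nat \<Rightarrow> 'a pair_pre_digraph \<Rightarrow> bool" where
  "regular_graph d G \<longleftrightarrow> (\<forall>v \<in> pverts G. out_degree (with_proj G) v = d)"

definition bipartite_graph :: "'a pair_pre_digraph \<Rightarrow> bool" where
  "bipartite_graph H \<longleftrightarrow>
    (\<exists>A B. A \<union> B = pverts H \<and> A \<inter> B = {} \<and> parcs H \<subseteq> A \<times> B \<union> B \<times> A)"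

definition complete_pair_graph :: "nat \<Rightarrow> nat pair_pre_digraph" where
  "complete_pair_graph n =
    \<lparr>pverts = {..<n}, parcs = {(u, v). u < n \<and> v < n \<and> u \<noteq> v}\<rparr>"

lemma complete_pair_graph_complete: "complete_digraph n (with_proj (complete_pair_graph n))"
  by (auto simp: complete_digraph_pair_def complete_pair_graph_def)

definition uedges :: "'a pair_pre_digraph \<Rightarrow> 'a set set" where
  "uedges H = {{u, v} | u v. (u, v) \<in> parcs H}"

definition opposite_in_4cycle :: "'a pair_pre_digraph \<Rightarrow> 'a set \<Rightarrow> 'a set \<Rightarrow> bool" where
  "opposite_in_4cycle H e f \<longleftrightarrow>
    (\<exists>a b c d. distinct [a, b, c, d] \<and>
       {(a, b), (b, c), (c, d), (d, a)} \<subseteq> parcs H \<and> e = {a, b} \<and> f = {c, d})"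

definition ext_line_graph :: "'a pair_pre_digraph \<Rightarrow> 'a set pair_pre_digraph" where
  "ext_line_graph H =
    \<lparr>pverts = uedges H,
     parcs = {(e, f). e \<in> uedges H \<and> f \<in> uedges H \<and>
                (e = f \<or> e \<inter> f \<noteq> {} \<or> opposite_in_4cycle H e f)}\<rparr>"

lemma finite_uedges: "finite (parcs H) \<Longrightarrow> finite (uedges H)"
proof -
  have "uedges H = (\<lambda>(u, v). {u, v}) ` parcs H"
    by (auto simp: uedges_def image_iff)
  then show "finite (parcs H) \<Longrightarrow> finite (uedges H)" by simp
qed

lemma opposite_in_4cycle_sym:
  assumes "opposite_in_4cycle H e f"
  shows "opposite_in_4cycle H f e"
proof -
  obtain a b c d where abcd: "distinct [a, b, c, d]"
    "{(a, b), (b, c), (c, d), (d, a)} \<subseteq> parcs H" "e = {a, b}" "f = {c, d}"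
    using assms unfolding opposite_in_4cycle_def by blast
  have "distinct [c, d, a, b]" using abcd(1) by auto
  moreover have "{(c, d), (d, a), (a, b), (b, c)} \<subseteq> parcs H" using abcd(2) by simp
  ultimately show ?thesis
    unfolding opposite_in_4cycle_def using abcd(3,4) by blast
qed

lemma pair_pseudo_graph_ext_line_graph:
  assumes "pair_graph H"
  shows "pair_pseudo_graph (ext_line_graph H)"
proof -
  interpret pair_graph H by fact
  have fin: "finite (uedges H)" by (rule finite_uedges) (rule pair_finite_arcs)
  show ?thesis
  proof
    show "finite (parcs (ext_line_graph H))"
      by (rule finite_subset[OF _ finite_cartesian_product[OF fin fin]])
        (auto simp: ext_line_graph_def)
    show "symmetric (with_proj (ext_line_graph H))"
      unfolding symmetric_def with_proj_simps
    proof (rule symI)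
      fix e f assume "(e, f) \<in> parcs (ext_line_graph H)"
      then show "(f, e) \<in> parcs (ext_line_graph H)"
        using opposite_in_4cycle_sym[of H e f] by (auto simp: ext_line_graph_def)
    qed
  qed (use fin in \<open>auto simp: ext_line_graph_def\<close>)
qed

end

theory Submission
  imports Defs "HOL-Analysis.Convex"
begin

text \<open>
  Let \<open>A\<close>, \<open>B\<close> be the sides of \<open>H\<close>, and let \<open>G'\<close> be the bipartite double cover of \<open>G\<close> with a loop
  added at every vertex; it is \<open>(d + 1)\<close>-regular. Reading an edge of \<open>H\<close> as a pair in \<open>A \<times> B\<close>,
  the pairs \<open>(a, b)\<close> and \<open>(a', b')\<close> are adjacent in the extended line graph iff \<open>a b'\<close> and \<open>a' b\<close>
  are edges of \<open>H\<close>. Hence homomorphisms from \<open>G\<close> to the extended line graph are the same as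
  side-preserving homomorphisms from \<open>G'\<close> to \<open>H\<close>, and \<open>K\<^bsub>d+1\<^esub>\<close> corresponds to \<open>K\<^bsub>d+1,d+1\<^esub>\<close>.
  Summing out the maps into \<open>B\<close> leaves a sum over maps \<open>f\<close> into \<open>A\<close> of a product of factors, one for
  each vertex, that depend on \<open>f\<close> only on the closed neighbourhood. Each vertex lies in \<open>d + 1\<close>
  closed neighbourhoods, so Finner's generalization of Hoelder's inequality gives the bound.
\<close>

section \<open>Hoelder and Finner inequalities for sums over maps\<close>

text \<open>Dividing each \<open>h i\<close> by its l^D norm, where D = \<open>card I\<close>,
  reduces the claim to norm 1. There the product is bounded pointwise by the arithmetic-geometric
  mean inequality, and the bound is summed over \<open>A\<close>.\<close>

lemma Holder_inequality_prod:
  fixes h :: "'i \<Rightarrow> 'a \<Rightarrow> real"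
  assumes I: "finite I" "I \<noteq> {}"
    and nonneg: "\<And>i a. i \<in> I \<Longrightarrow> a \<in> A \<Longrightarrow> h i a \<ge> 0"
  shows "(\<Sum>a\<in>A. \<Prod>i\<in>I. h i a) \<le> (\<Prod>i\<in>I. root (card I) (\<Sum>a\<in>A. h i a ^ card I))"
proof (cases "finite A")
  \<comment> \<open>Sums over an infinite set are 0 by convention, so both sides vanish.\<close>
  case False
  then show ?thesis by (simp add: I prod_nonneg)
next
  case A: True
  define D where "D = card I"
  have D: "D > 0" using I by (simp add: D_def card_gt_0_iff)
  define s where "s i = (\<Sum>a\<in>A. h i a ^ D)" for i
  have s_nonneg: "s i \<ge> 0" if "i \<in> I" for i
    unfolding s_def by (intro sum_nonneg zero_le_power nonneg that)
  show ?thesis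
  proof (cases "\<exists>i\<in>I. s i = 0")
    case True
    then obtain i where i: "i \<in> I" "s i = 0" by blast
    \<comment> \<open>A factor of norm 0 vanishes on all of \<open>A\<close> and takes the left side
      with it; normalising would divide by 0 here.\<close>
    have "h i a = 0" if "a \<in> A" for a
    proof -
      have "h i a ^ D = 0"
        using i(2) sum_nonneg_eq_0_iff[OF A, of "\<lambda>a. h i a ^ D"] nonneg[OF i(1)] that
        by (auto simp: s_def)
      then show ?thesis by simp
    qed
    then have "(\<Prod>i\<in>I. h i a) = 0" if "a \<in> A" for a
      using that i(1) I by (auto intro: prod_zero)
    then have "(\<Sum>a\<in>A. \<Prod>i\<in>I. h i a) = 0" by simp
    also have "0 \<le> (\<Prod>i\<in>I. root D (s i))"
      by (intro prod_nonneg) (use s_nonneg D in simp)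
    finally show ?thesis by (simp add: s_def D_def)
  next
    case False
    then have s_pos: "s i > 0" if "i \<in> I" for i
      using s_nonneg[OF that] that by fastforce
    define R where "R = (\<Prod>i\<in>I. root D (s i))"
    have R: "R > 0" unfolding R_def by (intro prod_pos) (use s_pos D in simp)
    \<comment> \<open>The left side is the geometric mean of the \<open>D\<close> numbers
      \<open>h i a ^ D / s i\<close>, the right side their arithmetic mean.\<close>
    have "(\<Prod>i\<in>I. h i a) / R \<le> (\<Sum>i\<in>I. (h i a ^ D / s i) / D)" if a: "a \<in> A" for a
    proof -
      have "(\<Prod>i\<in>I. h i a) / R = (\<Prod>i\<in>I. root D (h i a ^ D / s i))"
        unfolding R_def prod_dividef[symmetric]
        by (intro prod.cong) (use D nonneg a in \<open>auto simp: real_root_divide real_root_power_cancel\<close>)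
      also have "\<dots> = root D (\<Prod>i\<in>I. h i a ^ D / s i)"
        using I(1) by (induction rule: finite_induct)
          (use D in \<open>simp_all add: real_root_mult del: times_divide_eq_left times_divide_eq_right\<close>)
      also have "\<dots> = (\<Prod>i\<in>I. h i a ^ D / s i) powr (1 / D)"
        by (intro root_powr_inverse D prod_nonneg) (use nonneg a s_nonneg in auto)
      also have "\<dots> \<le> (\<Sum>i\<in>I. (h i a ^ D / s i) / D)"
        unfolding D_def by (rule arith_geom_mean[OF I]) (use nonneg a s_nonneg D_def in auto)
      finally show ?thesis .
    qed
    then have "(\<Sum>a\<in>A. (\<Prod>i\<in>I. h i a) / R) \<le> (\<Sum>a\<in>A. \<Sum>i\<in>I. (h i a ^ D / s i) / D)"
      by (rule sum_mono)
    also have "\<dots> = (\<Sum>i\<in>I. s i / s i / D)"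
      by (subst sum.swap) (simp only: s_def[symmetric] sum_divide_distrib[symmetric])
    also have "\<dots> = (\<Sum>i\<in>I. 1 / D)"
      by (intro sum.cong) (use s_pos in \<open>auto simp: less_le\<close>)
    also have "\<dots> = 1" using D by (simp add: D_def)
    finally have "(\<Sum>a\<in>A. \<Prod>i\<in>I. h i a) \<le> R"
      using R by (simp add: sum_divide_distrib[symmetric])
    then show ?thesis by (simp add: R_def s_def D_def)
  qed
qed

lemma sum_PiE_insert:
  assumes "x \<notin> X"
  shows "(\<Sum>f\<in>insert x X \<rightarrow>\<^sub>E A. g f) = (\<Sum>f\<in>X \<rightarrow>\<^sub>E A. \<Sum>a\<in>A. g (f(x := a)))"
proof -
  have "(\<Sum>f\<in>insert x X \<rightarrow>\<^sub>E A. g f) = (\<Sum>(a, f)\<in>A \<times> (X \<rightarrow>\<^sub>E A). g (f(x := a)))"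
    unfolding PiE_insert_eq using inj_combinator[OF assms, of "\<lambda>_. A"]
    by (subst sum.reindex) (auto simp: case_prod_unfold)
  also have "\<dots> = (\<Sum>a\<in>A. \<Sum>f\<in>X \<rightarrow>\<^sub>E A. g (f(x := a)))"
    by (simp add: sum.cartesian_product)
  also have "\<dots> = (\<Sum>f\<in>X \<rightarrow>\<^sub>E A. \<Sum>a\<in>A. g (f(x := a)))" by (rule sum.swap)
  finally show ?thesis .
qed

text \<open>One coordinate is summed out at a time, by Hoelder's inequality for the \<open>D\<close> factors that depend on it.\<close>

lemma Finner_inequality:
  fixes F :: "'y \<Rightarrow> ('x \<Rightarrow> 'a) \<Rightarrow> real" and A :: "'a set"
  assumes "finite X" "finite Y" "D > 0"
    and "\<And>y. y \<in> Y \<Longrightarrow> N y \<subseteq> X"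
    and "\<And>x. x \<in> X \<Longrightarrow> card {y \<in> Y. x \<in> N y} = D"
    and "\<And>y f. y \<in> Y \<Longrightarrow> F y f \<ge> 0"
  shows "(\<Sum>f\<in>X \<rightarrow>\<^sub>E A. \<Prod>y\<in>Y. F y (restrict f (N y)))
    \<le> (\<Prod>y\<in>Y. root D (\<Sum>g\<in>N y \<rightarrow>\<^sub>E A. F y g ^ D))"
  using assms(1,4-6)
proof (induction X arbitrary: N F rule: finite_induct)
  case empty
  have "N y = {}" if "y \<in> Y" for y using empty.prems(1)[OF that] by simp
  then show ?case
    using \<open>D > 0\<close> empty.prems(3) by (simp add: real_root_power_cancel restrict_def)
next
  case (insert x X)
  define N' where "N' y = N y - {x}" for y
  \<comment> \<open>A factor that depends on \<open>x\<close> is replaced by its l^D norm in that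
    coordinate. This leaves the right side of the claim unchanged, so the induction hypothesis for
    \<open>F'\<close> and \<open>N'\<close> suffices.\<close>
  define F' where "F' y g =
    (if x \<in> N y then root D (\<Sum>a\<in>A. F y (g(x := a)) ^ D) else F y g)" for y g
  define Y1 where "Y1 = {y \<in> Y. x \<in> N y}"
  define Y0 where "Y0 = {y \<in> Y. x \<notin> N y}"
  have Y: "Y = Y1 \<union> Y0" "Y1 \<inter> Y0 = {}" "finite Y1" "finite Y0"
    using \<open>finite Y\<close> by (auto simp: Y1_def Y0_def)
  have card_Y1: "card Y1 = D" using insert.prems(2)[of x] by (simp add: Y1_def)
  then have Y1_ne: "Y1 \<noteq> {}" using \<open>D > 0\<close> by auto
  have "(\<Sum>f\<in>insert x X \<rightarrow>\<^sub>E A. \<Prod>y\<in>Y. F y (restrict f (N y)))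
    = (\<Sum>f\<in>X \<rightarrow>\<^sub>E A. \<Sum>a\<in>A. \<Prod>y\<in>Y. F y (restrict (f(x := a)) (N y)))"
    by (rule sum_PiE_insert[OF insert.hyps(2)])
  also have "\<dots> \<le> (\<Sum>f\<in>X \<rightarrow>\<^sub>E A. \<Prod>y\<in>Y. F' y (restrict f (N' y)))"
  proof (rule sum_mono)
    fix f :: "'x \<Rightarrow> 'a"
    have eq1: "restrict (f(x := a)) (N y) = (restrict f (N' y))(x := a)" if "y \<in> Y1" for y a
      using that by (auto simp: N'_def Y1_def restrict_def)
    have eq0: "restrict (f(x := a)) (N y) = restrict f (N' y)" if "y \<in> Y0" for y a
      using that by (auto simp: N'_def Y0_def restrict_def)
    have "(\<Sum>a\<in>A. \<Prod>y\<in>Y. F y (restrict (f(x := a)) (N y)))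
      = (\<Sum>a\<in>A. (\<Prod>y\<in>Y1. F y ((restrict f (N' y))(x := a))) * (\<Prod>y\<in>Y0. F y (restrict f (N' y))))"
      unfolding Y(1) by (subst prod.union_disjoint) (use Y eq1 eq0 in auto)
    also have "\<dots> = (\<Sum>a\<in>A. \<Prod>y\<in>Y1. F y ((restrict f (N' y))(x := a)))
        * (\<Prod>y\<in>Y0. F y (restrict f (N' y)))"
      by (simp add: sum_distrib_right)
    \<comment> \<open>Exactly \<open>D\<close> factors involve \<open>x\<close>, so Hoelder's
      inequality over \<open>Y1\<close> has exponent \<open>D\<close>.\<close>
    also have "\<dots> \<le> (\<Prod>y\<in>Y1. root D (\<Sum>a\<in>A. F y ((restrict f (N' y))(x := a)) ^ D))
        * (\<Prod>y\<in>Y0. F y (restrict f (N' y)))"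
      unfolding card_Y1[symmetric]
      by (intro mult_right_mono Holder_inequality_prod Y Y1_ne prod_nonneg insert.prems(3))
        (auto simp: Y1_def Y0_def)
    also have "\<dots> = (\<Prod>y\<in>Y1. F' y (restrict f (N' y))) * (\<Prod>y\<in>Y0. F' y (restrict f (N' y)))"
      by (intro arg_cong2[where f = "(*)"] prod.cong) (auto simp: F'_def Y1_def Y0_def)
    also have "\<dots> = (\<Prod>y\<in>Y. F' y (restrict f (N' y)))"
      unfolding Y(1) by (rule prod.union_disjoint[symmetric]) (use Y in auto)
    finally show "(\<Sum>a\<in>A. \<Prod>y\<in>Y. F y (restrict (f(x := a)) (N y)))
      \<le> (\<Prod>y\<in>Y. F' y (restrict f (N' y)))" .
  qed
  also have "\<dots> \<le> (\<Prod>y\<in>Y. root D (\<Sum>g\<in>N' y \<rightarrow>\<^sub>E A. F' y g ^ D))"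
  proof (rule insert.IH)
    show "N' y \<subseteq> X" if "y \<in> Y" for y
      using insert.prems(1)[OF that] by (auto simp: N'_def)
    show "card {y \<in> Y. z \<in> N' y} = D" if "z \<in> X" for z
    proof -
      have "z \<noteq> x" using that insert.hyps(2) by auto
      then show ?thesis using insert.prems(2)[of z] that by (simp add: N'_def)
    qed
    show "F' y f \<ge> 0" if "y \<in> Y" for y f
      using insert.prems(3)[OF that] \<open>D > 0\<close> by (auto simp: F'_def intro!: sum_nonneg)
  qed
  also have "\<dots> = (\<Prod>y\<in>Y. root D (\<Sum>g\<in>N y \<rightarrow>\<^sub>E A. F y g ^ D))"
  proof (rule prod.cong[OF refl])
    fix y assume y: "y \<in> Y"
    \<comment> \<open>The power cancels the root in \<open>F'\<close>, and the inner sum over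
      \<open>a\<close> restores the coordinate \<open>x\<close>.\<close>
    have "(\<Sum>g\<in>N' y \<rightarrow>\<^sub>E A. F' y g ^ D) = (\<Sum>g\<in>N y \<rightarrow>\<^sub>E A. F y g ^ D)"
    proof (cases "x \<in> N y")
      case True
      then have "insert x (N' y) = N y" "x \<notin> N' y" by (auto simp: N'_def)
      moreover have "F' y g ^ D = (\<Sum>a\<in>A. F y (g(x := a)) ^ D)" for g
        using True \<open>D > 0\<close> insert.prems(3)[OF y]
        by (auto simp: F'_def intro!: real_root_pow_pos2 sum_nonneg)
      ultimately show ?thesis using sum_PiE_insert[of x "N' y" "\<lambda>g. F y g ^ D" A] by simp
    qed (simp add: F'_def N'_def)
    then show "root D (\<Sum>g\<in>N' y \<rightarrow>\<^sub>E A. F' y g ^ D) = root D (\<Sum>g\<in>N y \<rightarrow>\<^sub>E A. F y g ^ D)"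
      by simp
  qed
  finally show ?case .
qed

text \<open>Composing with a bijection between the domains keeps the image of a map. This later
  identifies the sum over each closed neighbourhood with the one for the complete graph.\<close>

lemma sum_PiE_image_cong_card:
  assumes "finite S" "finite T" "card S = card T"
  shows "(\<Sum>f\<in>S \<rightarrow>\<^sub>E A. g (f ` S)) = (\<Sum>f\<in>T \<rightarrow>\<^sub>E A. g (f ` T))"
proof -
  obtain p where p: "bij_betw p S T" using finite_same_card_bij assms by blast
  define q where "q = inv_into S p"
  have q: "bij_betw q T S" unfolding q_def by (rule bij_betw_inv_into[OF p])
  have pS: "p s \<in> T" "q (p s) = s" if "s \<in> S" for s
    using p that by (auto simp: q_def bij_betw_def)
  have qT: "q t \<in> S" "p (q t) = t" if "t \<in> T" for t
    using p q that by (auto simp: q_def bij_betw_def f_inv_into_f)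
  show ?thesis
  proof (rule sum.reindex_bij_witness[where j = "\<lambda>f. restrict (f \<circ> q) T"
        and i = "\<lambda>f. restrict (f \<circ> p) S"])
    fix f assume f: "f \<in> S \<rightarrow>\<^sub>E A"
    show "restrict (restrict (f \<circ> q) T \<circ> p) S = f"
      using f pS by (auto simp: fun_eq_iff PiE_def extensional_def restrict_def)
    show "restrict (f \<circ> q) T \<in> T \<rightarrow>\<^sub>E A" using f qT by auto
    have "restrict (f \<circ> q) T ` T = f ` q ` T" by auto
    then show "g (restrict (f \<circ> q) T ` T) = g (f ` S)"
      using q by (simp add: bij_betw_def)
  next
    fix f assume f: "f \<in> T \<rightarrow>\<^sub>E A"
    show "restrict (restrict (f \<circ> p) S \<circ> q) T = f"
      using f qT by (auto simp: fun_eq_iff PiE_def extensional_def restrict_def)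
    show "restrict (f \<circ> p) S \<in> S \<rightarrow>\<^sub>E A" using f pS by auto
  qed
qed

section \<open>Homomorphisms into the extended line graph\<close>

definition closed_nbhd :: "'a pair_pre_digraph \<Rightarrow> 'a \<Rightarrow> 'a set" where
  "closed_nbhd G v = insert v {u. (v, u) \<in> parcs G}"

text \<open>These are the images in \<open>B\<close> open to a vertex of the double cover whose
  neighbours are mapped onto \<open>S\<close>.\<close>

definition common_nbhd :: "'a pair_pre_digraph \<Rightarrow> 'a set \<Rightarrow> 'a set \<Rightarrow> 'a set" where
  "common_nbhd H B S = {b \<in> B. \<forall>a\<in>S. (a, b) \<in> parcs H}"

lemma pair_graph_parcs_sym: "pair_graph G \<Longrightarrow> (u, v) \<in> parcs G \<Longrightarrow> (v, u) \<in> parcs G"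
proof -
  assume "pair_graph G"
  then interpret pair_graph G .
  show "(u, v) \<in> parcs G \<Longrightarrow> (v, u) \<in> parcs G"
    using pair_sym_arcs by (auto simp: symmetric_def elim: symE)
qed

text \<open>If the edges share an end, the two cross pairs are the given edges themselves. Otherwise
  the cross pairs are the other two sides of a 4-cycle in which the given edges are
  opposite.\<close>

lemma ext_line_graph_adj_iff:
  assumes H: "pair_graph H"
    and AB: "A \<inter> B = {}" "parcs H \<subseteq> A \<times> B \<union> B \<times> A"
    and a: "a \<in> A" "a' \<in> A" and b: "b \<in> B" "b' \<in> B"
    and ab: "(a, b) \<in> parcs H" "(a', b') \<in> parcs H"
  shows "({a, b}, {a', b'}) \<in> parcs (ext_line_graph H) \<longleftrightarrow> (a, b') \<in> parcs H \<and> (a', b) \<in> parcs H"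
proof -
  note sym = pair_graph_parcs_sym[OF H]
  have ne: "x \<noteq> y" if "x \<in> A" "y \<in> B" for x y using that AB(1) by auto
  have edges: "{a, b} \<in> uedges H" "{a', b'} \<in> uedges H" using ab by (auto simp: uedges_def)
  show ?thesis
  proof
    assume "({a, b}, {a', b'}) \<in> parcs (ext_line_graph H)"
    then consider "{a, b} \<inter> {a', b'} \<noteq> {}" | "opposite_in_4cycle H {a, b} {a', b'}"
      by (auto simp: ext_line_graph_def)
    then show "(a, b') \<in> parcs H \<and> (a', b) \<in> parcs H"
    proof cases
      case 1
      then have "a = a' \<or> b = b'" using ne a b by blast
      then show ?thesis using ab by auto
    next
      case 2
      then obtain p q r s where
        cycle: "{(p, q), (q, r), (r, s), (s, p)} \<subseteq> parcs H"
        and ends: "{a, b} = {p, q}" "{a', b'} = {r, s}"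
        unfolding opposite_in_4cycle_def by (elim exE conjE)
      have c: "(q, r) \<in> parcs H" "(s, p) \<in> parcs H" using cycle by auto
      have "p = a \<and> q = b \<or> p = b \<and> q = a" "r = a' \<and> s = b' \<or> r = b' \<and> s = a'"
        using ends by (auto simp: doubleton_eq_iff)
      moreover have "(b, b') \<notin> parcs H" "(a, a') \<notin> parcs H"
        using subsetD[OF AB(2), of "(b, b')"] subsetD[OF AB(2), of "(a, a')"] AB(1) a b by auto
      \<comment> \<open>Neighbours \<open>q\<close> and \<open>r\<close> on the cycle lie on
        different sides of \<open>H\<close>, which excludes the two mixed labellings.\<close>
      ultimately have "p = a \<and> q = b \<and> r = a' \<and> s = b' \<or> p = b \<and> q = a \<and> r = b' \<and> s = a'"
        using c(1) by metis
      then show ?thesis using c sym by metis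
    qed
  next
    assume cross: "(a, b') \<in> parcs H \<and> (a', b) \<in> parcs H"
    show "({a, b}, {a', b'}) \<in> parcs (ext_line_graph H)"
    proof (cases "a = a' \<or> b = b'")
      case True
      then show ?thesis using edges by (auto simp: ext_line_graph_def)
    next
      case False
      then have "distinct [a, b, a', b']" using ne a b by auto
      moreover have "{(a, b), (b, a'), (a', b'), (b', a)} \<subseteq> parcs H"
        using ab cross sym by auto
      ultimately have "opposite_in_4cycle H {a, b} {a', b'}"
        unfolding opposite_in_4cycle_def by blast
      then show ?thesis using edges by (auto simp: ext_line_graph_def)
    qed
  qed
qed

text \<open>A homomorphism splits into the map \<open>f\<close> of \<open>A\<close>-ends and the map
  \<open>g\<close> of \<open>B\<close>-ends. Once \<open>f\<close> is fixed, the values of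
  \<open>g\<close> at different vertices are chosen independently, hence the product.\<close>

lemma hom_count_ext_line_graph:
  fixes H :: "'b pair_pre_digraph" and G :: "'a pair_pre_digraph"
  assumes H: "pair_graph H" and G: "pair_graph G"
    and AB: "A \<union> B = pverts H" "A \<inter> B = {}" "parcs H \<subseteq> A \<times> B \<union> B \<times> A"
  shows "hom_count G (ext_line_graph H)
    = (\<Sum>f\<in>pverts G \<rightarrow>\<^sub>E A. \<Prod>v\<in>pverts G. card (common_nbhd H B (f ` closed_nbhd G v)))"
proof -
  interpret H: pair_graph H by fact
  interpret G: pair_graph G by fact
  define V where "V = pverts G"
  have fin: "finite V" "finite A" "finite B"
    using G.pair_finite_verts H.pair_finite_verts AB(1)[symmetric] by (auto simp: V_def)
  have arcV: "u \<in> V" "v \<in> V" if "(u, v) \<in> parcs G" for u v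
    using G.arc_fst_in_verts[OF that] G.arc_snd_in_verts[OF that] by (auto simp: V_def)
  define P where "P = (SIGMA f : V \<rightarrow>\<^sub>E A. \<Pi>\<^sub>E v\<in>V. common_nbhd H B (f ` closed_nbhd G v))"
  define \<Phi> :: "('a \<Rightarrow> 'b) \<times> ('a \<Rightarrow> 'b) \<Rightarrow> 'a \<Rightarrow> 'b set"
    where "\<Phi> = (\<lambda>(f, g). \<lambda>v\<in>V. {f v, g v})"
  have P_iff: "(f, g) \<in> P \<longleftrightarrow> f \<in> V \<rightarrow>\<^sub>E A \<and> g \<in> V \<rightarrow>\<^sub>E B \<and> (\<forall>v\<in>V. (f v, g v) \<in> parcs H) \<and>
      (\<forall>(u, v)\<in>parcs G. (f v, g u) \<in> parcs H)" for f g
  proof -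
    have "(\<forall>u\<in>V. \<forall>v. (u, v) \<in> parcs G \<longrightarrow> (f v, g u) \<in> parcs H)
        \<longleftrightarrow> (\<forall>(u, v)\<in>parcs G. (f v, g u) \<in> parcs H)"
      using arcV by blast
    then show ?thesis
      unfolding P_def mem_Sigma_iff PiE_iff common_nbhd_def closed_nbhd_def by blast
  qed
  have adj: "({f u, g u}, {f v, g v}) \<in> parcs (ext_line_graph H)
      \<longleftrightarrow> (f u, g v) \<in> parcs H \<and> (f v, g u) \<in> parcs H"
    if "f \<in> V \<rightarrow>\<^sub>E A" "g \<in> V \<rightarrow>\<^sub>E B" "\<forall>v\<in>V. (f v, g v) \<in> parcs H" "u \<in> V" "v \<in> V" for f g u v
    using that by (intro ext_line_graph_adj_iff[OF H AB(2,3)]) auto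
  have "bij_betw \<Phi> P (graph_homs G (ext_line_graph H))"
  proof (rule bij_betw_imageI)
    show "inj_on \<Phi> P"
    proof (rule inj_onI, clarify)
      fix f g f' g'
      assume fg: "(f, g) \<in> P" "(f', g') \<in> P" and eq: "\<Phi> (f, g) = \<Phi> (f', g')"
      have "f v = f' v \<and> g v = g' v" if v: "v \<in> V" for v
      proof -
        have "{f v, g v} = {f' v, g' v}" using fun_cong[OF eq, of v] v by (simp add: \<Phi>_def)
        moreover have "f v \<in> A" "f' v \<in> A" "g v \<in> B" "g' v \<in> B"
          using fg v by (auto simp: P_iff)
        ultimately show ?thesis using AB(2) by (auto simp: doubleton_eq_iff)
      qed
      then show "f = f' \<and> g = g'" using fg by (auto simp: P_iff intro: PiE_ext)
    qed
    show "\<Phi> ` P = graph_homs G (ext_line_graph H)"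
    proof (intro equalityI subsetI)
      fix \<phi> assume "\<phi> \<in> \<Phi> ` P"
      then obtain f g where fg: "(f, g) \<in> P" and \<phi>: "\<phi> = (\<lambda>v\<in>V. {f v, g v})"
        by (auto simp: \<Phi>_def)
      have "\<phi> \<in> V \<rightarrow>\<^sub>E uedges H" using fg by (fastforce simp: \<phi> P_iff uedges_def)
      \<comment> \<open>The two cross pairs come from the arcs \<open>(u, v)\<close> and
        \<open>(v, u)\<close>.\<close>
      moreover have "(\<phi> u, \<phi> v) \<in> parcs (ext_line_graph H)" if uv: "(u, v) \<in> parcs G" for u v
        using fg arcV[OF uv] adj[of f g u v] uv pair_graph_parcs_sym[OF G uv]
        by (auto simp: \<phi> P_iff)
      moreover have "pverts (ext_line_graph H) = uedges H" by (simp add: ext_line_graph_def)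
      ultimately show "\<phi> \<in> graph_homs G (ext_line_graph H)"
        by (auto simp: graph_homs_def V_def)
    next
      fix \<phi> assume \<phi>: "\<phi> \<in> graph_homs G (ext_line_graph H)"
      have "\<exists>a b. \<phi> v = {a, b} \<and> a \<in> A \<and> b \<in> B \<and> (a, b) \<in> parcs H" if "v \<in> V" for v
      proof -
        have "\<phi> v \<in> uedges H"
          using \<phi> that by (auto simp: graph_homs_def ext_line_graph_def V_def)
        then obtain p q where pq: "\<phi> v = {p, q}" "(p, q) \<in> parcs H" by (auto simp: uedges_def)
        then have "(q, p) \<in> parcs H" by (auto intro: pair_graph_parcs_sym[OF H])
        then show ?thesis using pq AB(3) by (metis UnE insert_commute mem_Sigma_iff subsetD)
      qed
      then obtain f0 g0 where fg0: "\<And>v. v \<in> V \<Longrightarrow>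
          \<phi> v = {f0 v, g0 v} \<and> f0 v \<in> A \<and> g0 v \<in> B \<and> (f0 v, g0 v) \<in> parcs H" by metis
      define f g where "f = restrict f0 V" and "g = restrict g0 V"
      have \<phi>_eq: "\<phi> v = {f v, g v}" if "v \<in> V" for v
        using fg0 that by (simp add: f_def g_def)
      have fg: "f \<in> V \<rightarrow>\<^sub>E A" "g \<in> V \<rightarrow>\<^sub>E B" "\<forall>v\<in>V. (f v, g v) \<in> parcs H"
        using fg0 by (auto simp: f_def g_def)
      have "(f v, g u) \<in> parcs H" if uv: "(u, v) \<in> parcs G" for u v
      proof -
        have "(\<phi> u, \<phi> v) \<in> parcs (ext_line_graph H)" using \<phi> uv by (auto simp: graph_homs_def)
        then show ?thesis using adj[OF fg arcV[OF uv]] arcV[OF uv] by (simp add: \<phi>_eq)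
      qed
      then have "(f, g) \<in> P" using fg by (auto simp: P_iff)
      moreover have "\<phi> = \<Phi> (f, g)"
        using \<phi> by (auto simp: \<Phi>_def fun_eq_iff \<phi>_eq graph_homs_def V_def PiE_def extensional_def)
      ultimately show "\<phi> \<in> \<Phi> ` P" by blast
    qed
  qed
  then have "hom_count G (ext_line_graph H) = card P"
    by (simp add: hom_count_def bij_betw_same_card)
  also have "\<dots> = (\<Sum>f\<in>V \<rightarrow>\<^sub>E A. card (\<Pi>\<^sub>E v\<in>V. common_nbhd H B (f ` closed_nbhd G v)))"
    unfolding P_def
    by (rule card_SigmaI) (use fin in \<open>auto intro!: finite_PiE simp: common_nbhd_def\<close>)
  finally show ?thesis using fin(1) by (simp add: card_PiE V_def)
qed

section \<open>Regularity and the final bound\<close>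

lemma card_closed_nbhd:
  assumes "pair_graph G" "regular_graph d G" "v \<in> pverts G"
  shows "card (closed_nbhd G v) = d + 1"
proof -
  interpret pair_graph G by fact
  have "out_arcs (with_proj G) v = Pair v ` {u. (v, u) \<in> parcs G}"
    by (auto simp: out_arcs_def)
  then have "card (out_arcs (with_proj G) v) = card {u. (v, u) \<in> parcs G}"
    by (simp add: card_image inj_on_def)
  then have "card {u. (v, u) \<in> parcs G} = d"
    using assms(2,3) by (simp add: regular_graph_def out_degree_def)
  moreover have "v \<notin> {u. (v, u) \<in> parcs G}" using pair_no_loops by fastforce
  moreover have "finite {u. (v, u) \<in> parcs G}"
    by (rule finite_subset[OF _ pair_finite_verts]) (use arc_snd_in_verts in fastforce)
  ultimately show ?thesis by (simp add: closed_nbhd_def)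
qed

lemma pair_graph_complete: "pair_graph (complete_pair_graph n)"
proof
  show "finite (parcs (complete_pair_graph n))"
    by (rule finite_subset[of _ "{..<n} \<times> {..<n}"]) (auto simp: complete_pair_graph_def)
qed (auto simp: complete_pair_graph_def symmetric_def sym_def)

theorem theorem2:
  fixes H :: "'b pair_pre_digraph" and G :: "'a pair_pre_digraph" and d n :: nat
  assumes "pair_graph H" and "bipartite_graph H"
    and "d \<ge> 1"
    and "pair_graph G" and "regular_graph d G"
    and "card (pverts G) = n" and "n \<ge> 1"
  shows "real (hom_count G (ext_line_graph H))
           \<le> real (hom_count (complete_pair_graph (d + 1)) (ext_line_graph H))
               powr (real n / real (d + 1))
         \<and> normalized_hom_count (ext_line_graph H) G
           \<le> normalized_hom_count (ext_line_graph H) (complete_pair_graph (d + 1))"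
proof -
  interpret G: pair_graph G by fact
  obtain A B where AB: "A \<union> B = pverts H" "A \<inter> B = {}" "parcs H \<subseteq> A \<times> B \<union> B \<times> A"
    using assms(2) by (auto simp: bipartite_graph_def)
  define D where "D = d + 1"
  define c where "c S = card (common_nbhd H B S)" for S
  define N where "N = closed_nbhd G"
  define V where "V = pverts G"
  define M where "M = hom_count (complete_pair_graph D) (ext_line_graph H)"
  have D: "D > 0" by (simp add: D_def)
  have finV: "finite V" using G.pair_finite_verts by (simp add: V_def)
  have NV: "N v \<subseteq> V" if "v \<in> V" for v
    using that G.arc_snd_in_verts by (fastforce simp: N_def V_def closed_nbhd_def)
  have card_N: "card (N v) = D" if "v \<in> V" for v
    using card_closed_nbhd[OF assms(4,5)] that by (simp add: N_def V_def D_def)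
  \<comment> \<open>By symmetry each vertex lies in as many closed neighbourhoods as its own has
    elements, namely \<open>D\<close>, as Finner's inequality requires.\<close>
  have N_sym: "{y \<in> V. x \<in> N y} = N x" if "x \<in> V" for x
    using NV[OF that] pair_graph_parcs_sym[OF assms(4)] that
    by (auto simp: N_def closed_nbhd_def)
  have "closed_nbhd (complete_pair_graph D) v = {..<D}" if "v < D" for v
    using that by (auto simp: closed_nbhd_def complete_pair_graph_def)
  \<comment> \<open>In the complete graph all \<open>D\<close> closed neighbourhoods coincide, so
    the product is a \<open>D\<close>-th power, the form of the sums in Finner's bound.\<close>
  then have M: "M = (\<Sum>f\<in>{..<D} \<rightarrow>\<^sub>E A. c (f ` {..<D}) ^ D)"
    unfolding M_def hom_count_ext_line_graph[OF assms(1) pair_graph_complete AB]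
    by (simp add: complete_pair_graph_def c_def)
  have M_eq: "(\<Sum>g\<in>N v \<rightarrow>\<^sub>E A. real (c (g ` N v)) ^ D) = M" if "v \<in> V" for v
    unfolding M of_nat_sum of_nat_power using card_N[OF that] NV[OF that] finV
    by (intro sum_PiE_image_cong_card[where g = "\<lambda>S. real (c S) ^ D"]) (auto intro: finite_subset)
  have "real (hom_count G (ext_line_graph H))
    = (\<Sum>f\<in>V \<rightarrow>\<^sub>E A. \<Prod>v\<in>V. real (c (restrict f (N v) ` N v)))"
    unfolding hom_count_ext_line_graph[OF assms(1,4) AB] by (simp add: c_def N_def V_def)
  also have "\<dots> \<le> (\<Prod>v\<in>V. root D (\<Sum>g\<in>N v \<rightarrow>\<^sub>E A. real (c (g ` N v)) ^ D))"
    by (rule Finner_inequality[where F = "\<lambda>v g. real (c (g ` N v))"])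
      (use finV D NV N_sym card_N in auto)
  also have "\<dots> = root D M ^ n" using assms(6) by (simp add: M_eq V_def)
  also have "\<dots> = (M powr (1 / D)) ^ n" using D by (simp add: root_powr_inverse)
  \<comment> \<open>\<open>M\<close> may be 0, and \<open>0 powr 0\<close> is 0 while
    \<open>0 ^ 0\<close> is 1; \<open>n\<close> being positive makes the two powers agree.\<close>
  also have "\<dots> = M powr (n / D)"
    using assms(7) by (simp add: powr_realpow' [symmetric] powr_powr)
  finally have main: "real (hom_count G (ext_line_graph H)) \<le> M powr (n / D)" .
  have "real (hom_count G (ext_line_graph H)) powr (1 / n) \<le> (M powr (n / D)) powr (1 / n)"
    by (rule powr_mono2) (use main in auto)
  also have "\<dots> = M powr (1 / D)" using assms(7) by (simp add: powr_powr)
  finally show ?thesis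
    using main assms(6)
    by (simp add: normalized_hom_count_def M_def D_def complete_pair_graph_def)
qed

end
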